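(* Let $G$ be a graph on $n$ vertices, $k$ a positive integer, and $\mathcal{F}$ a layered family of $G$ with thickness at most $k$. Let $A,B\subseteq V(G)$ and let $\{x_F\}_{F\in\mathcal{F}}$ be an optimal solution to the linear program: minimize $\sum_{F\in\mathcal{F}} x_F$ subject to $x_F\ge 0$ for all $F$ and $\sum_{F\in\mathcal{F},\,F\cap P\neq\emptyset} x_F\ge 1$ for every induced $A$--$B$ path $P$ in $G$. Then there exists an $A$--$B$ separator $S$ in $G$ such that $\mathrm{fcov}_{\mathcal{F}}(S)\le 8k\cdot\log 2n\cdot\sum_{F\in\mathcal{F}} x_F$.
   Context: Logarithms are base 2. Layered family: given an ordered partition $\Pi=(L_1,\dots,L_m)$ of $V(G)$, the layer digraph has an arc $(u,v)$ iff $uv\in E(G)$ and $u\in L_i$, $v\in L_j$ with $j<i$. $v$ is a descendant of $u$ if there is a directed path from $u$ to $v$ (each vertex is its own descendant). For every vertex $u$ with no in-arcs, the set consisting of $u$ and all its descendants is put into $\mathcal{F}$; $u$ is its center. A family is a layered family of $G$ if it arises this way from some ordered partition; its thickness is the smallest $k$ such that every member meets at most $k$ parts of $\Pi$. An $A$--$B$ path starts in $A$ and ends in $B$; an $A$--$B$ separator meets every $A$--$B$ path. For $S\subseteq V(G)$, $\mathrm{fcov}_{\mathcal{F}}(S)$ is the minimum of $\sum_F y_F$ over nonnegative reals $\{y_F\}_{F\in\mathcal{F}}$ with $\sum_{F\ni v} y_F\ge 1$ for every $v\in S$. *)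

theory Defs
  imports
    "HOL-Analysis.Analysis"
    "HOL-Library.Disjoint_Sets"
    "Graph_Theory.Graph_Theory"
begin

text \<open>
  A finite simple graph is a \<open>pair_graph\<close>: finite vertex set, symmetric loop-free adjacency
  relation \<open>parcs G\<close>.  The part $L_i$ is the list element \<open>\<L> ! (i - 1)\<close>.
\<close>

definition ordered_partition :: "'a set \<Rightarrow> 'a set list \<Rightarrow> bool" where
  "ordered_partition V \<L> \<longleftrightarrow> distinct \<L> \<and> partition_on V (set \<L>)"

definition layer_digraph :: "'a pair_pre_digraph \<Rightarrow> 'a set list \<Rightarrow> 'a pair_pre_digraph" where
  "layer_digraph G \<L> = \<lparr> pverts = pverts G,
     parcs = {(u, v). (u, v) \<in> parcs G \<and>
       (\<exists>i j. j < i \<and> i < length \<L> \<and> u \<in> \<L> ! i \<and> v \<in> \<L> ! j)} \<rparr>"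

text \<open>Paths are nonempty vertex lists, so the one-vertex path makes \<open>u\<close> a descendant of itself.\<close>

definition descendants :: "'a pair_pre_digraph \<Rightarrow> 'a \<Rightarrow> 'a set" where
  "descendants D u = {v. \<exists>p. vpath p (with_proj D) \<and> hd p = u \<and> last p = v}"

definition layered_family :: "'a pair_pre_digraph \<Rightarrow> 'a set list \<Rightarrow> 'a set set" where
  "layered_family G \<L> =
     {insert u (descendants (layer_digraph G \<L>) u) | u.
        u \<in> pverts G \<and> in_arcs (with_proj (layer_digraph G \<L>)) u = {}}"

definition thickness :: "'a set list \<Rightarrow> 'a set set \<Rightarrow> nat" where
  "thickness \<L> \<F> = (LEAST k. \<forall>F\<in>\<F>. card {L \<in> set \<L>. F \<inter> L \<noteq> {}} \<le> k)"

text \<open>Only the end vertices of an \<open>A\<close>--\<open>B\<close> path are constrained: inner vertices may lie in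
  \<open>A\<close> or \<open>B\<close>, and a single vertex of \<open>A \<inter> B\<close> is such a path.\<close>

definition AB_path :: "'a pair_pre_digraph \<Rightarrow> 'a set \<Rightarrow> 'a set \<Rightarrow> 'a list \<Rightarrow> bool" where
  "AB_path G A B p \<longleftrightarrow> vpath p (with_proj G) \<and> hd p \<in> A \<and> last p \<in> B"

definition induced_AB_path :: "'a pair_pre_digraph \<Rightarrow> 'a set \<Rightarrow> 'a set \<Rightarrow> 'a list \<Rightarrow> bool" where
  "induced_AB_path G A B p \<longleftrightarrow> AB_path G A B p \<and>
     (\<forall>i j. i < j \<and> j < length p \<and> (p ! i, p ! j) \<in> parcs G \<longrightarrow> j = Suc i)"

definition AB_separator :: "'a pair_pre_digraph \<Rightarrow> 'a set \<Rightarrow> 'a set \<Rightarrow> 'a set \<Rightarrow> bool" where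
  "AB_separator G A B S \<longleftrightarrow> S \<subseteq> pverts G \<and> (\<forall>p. AB_path G A B p \<longrightarrow> set p \<inter> S \<noteq> {})"

definition separator_LP_feasible ::
  "'a pair_pre_digraph \<Rightarrow> 'a set set \<Rightarrow> 'a set \<Rightarrow> 'a set \<Rightarrow> ('a set \<Rightarrow> real) \<Rightarrow> bool" where
  "separator_LP_feasible G \<F> A B x \<longleftrightarrow> (\<forall>F\<in>\<F>. x F \<ge> 0) \<and>
     (\<forall>p. induced_AB_path G A B p \<longrightarrow> (\<Sum>F\<in>{F \<in> \<F>. F \<inter> set p \<noteq> {}}. x F) \<ge> 1)"

definition separator_LP_optimal ::
  "'a pair_pre_digraph \<Rightarrow> 'a set set \<Rightarrow> 'a set \<Rightarrow> 'a set \<Rightarrow> ('a set \<Rightarrow> real) \<Rightarrow> bool" where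
  "separator_LP_optimal G \<F> A B x \<longleftrightarrow> separator_LP_feasible G \<F> A B x \<and>
     (\<forall>y. separator_LP_feasible G \<F> A B y \<longrightarrow> (\<Sum>F\<in>\<F>. x F) \<le> (\<Sum>F\<in>\<F>. y F))"

definition fractional_cover :: "'a set set \<Rightarrow> 'a set \<Rightarrow> ('a set \<Rightarrow> real) \<Rightarrow> bool" where
  "fractional_cover \<F> S y \<longleftrightarrow> (\<forall>F\<in>\<F>. y F \<ge> 0) \<and>
     (\<forall>v\<in>S. (\<Sum>F\<in>{F \<in> \<F>. v \<in> F}. y F) \<ge> 1)"

definition fcov :: "'a set set \<Rightarrow> 'a set \<Rightarrow> real" where
  "fcov \<F> S = (LEAST c. \<exists>y. fractional_cover \<F> S y \<and> c = (\<Sum>F\<in>\<F>. y F))"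

text \<open>The minimum in \<open>fcov\<close> exists whenever \<open>\<F>\<close> is finite and covers \<open>S\<close>; a layered family is
  finite and covers all vertices.\<close>

lemma fractional_cover_min_exists:
  assumes fin: "finite \<F>" and cov: "S \<subseteq> \<Union>\<F>"
  obtains y where "fractional_cover \<F> S y"
    "\<And>z. fractional_cover \<F> S z \<Longrightarrow> (\<Sum>F\<in>\<F>. y F) \<le> (\<Sum>F\<in>\<F>. z F)"
proof -
  define I where "I = (\<lambda>F. if F \<in> \<F> then {0..1::real} else {0})"
  define K where "K = (PiE UNIV I :: ('a set \<Rightarrow> real) set)"
  define C where "C = K \<inter> (\<Inter>v\<in>S. {y. (\<Sum>F\<in>{F \<in> \<F>. v \<in> F}. y F) \<ge> 1})"
  have contp: "continuous_on UNIV (\<lambda>y::'a set \<Rightarrow> real. \<Sum>F\<in>\<G>. y F)" for \<G>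
    by (intro continuous_intros continuous_on_product_coordinates)
  have "compactin (product_topology (\<lambda>_. euclidean) UNIV) K"
    unfolding K_def by (subst compactin_PiE) (auto simp: I_def)
  then have "compact K"
    by (simp add: euclidean_product_topology)
  moreover have "closed (\<Inter>v\<in>S. {y. (\<Sum>F\<in>{F \<in> \<F>. v \<in> F}. y F) \<ge> (1::real)})"
    by (intro closed_INT ballI closed_Collect_le contp continuous_on_const)
  ultimately have cC: "compact C"
    unfolding C_def by (rule compact_Int_closed)
  have trunc: "(\<lambda>F. if F \<in> \<F> then min 1 (z F) else 0) \<in> C"
    if z: "fractional_cover \<F> S z" for z
  proof -
    let ?t = "\<lambda>F. if F \<in> \<F> then min 1 (z F) else 0"
    have z0: "\<And>F. F \<in> \<F> \<Longrightarrow> 0 \<le> z F" using z by (auto simp: fractional_cover_def)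
    have "(\<Sum>F\<in>{F \<in> \<F>. v \<in> F}. ?t F) \<ge> 1" if v: "v \<in> S" for v
    proof (cases "\<exists>F0\<in>{F \<in> \<F>. v \<in> F}. z F0 \<ge> 1")
      case True
      then obtain F0 where F0: "F0 \<in> {F \<in> \<F>. v \<in> F}" "z F0 \<ge> 1" by blast
      have "?t F0 \<le> (\<Sum>F\<in>{F \<in> \<F>. v \<in> F}. ?t F)"
        by (rule member_le_sum) (use F0 fin z0 in auto)
      then show ?thesis using F0 by simp
    next
      case False
      then have "(\<Sum>F\<in>{F \<in> \<F>. v \<in> F}. ?t F) = (\<Sum>F\<in>{F \<in> \<F>. v \<in> F}. z F)"
        by (intro sum.cong) (auto simp: min_def)
      then show ?thesis using z v by (auto simp: fractional_cover_def)
    qed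
    then show ?thesis using z0 by (auto simp: C_def K_def I_def)
  qed
  have "fractional_cover \<F> S (\<lambda>_. 1)"
  proof -
    have "(1::real) \<le> (\<Sum>F\<in>{F \<in> \<F>. v \<in> F}. 1)" if "v \<in> S" for v
    proof -
      have "{F \<in> \<F>. v \<in> F} \<noteq> {}" using cov that by auto
      then have "card {F \<in> \<F>. v \<in> F} > 0" using fin by (simp add: card_gt_0_iff)
      then show ?thesis by simp
    qed
    then show ?thesis by (auto simp: fractional_cover_def)
  qed
  from trunc[OF this] have "C \<noteq> {}" by blast
  then obtain y where y: "y \<in> C" "\<forall>z\<in>C. (\<Sum>F\<in>\<F>. y F) \<le> (\<Sum>F\<in>\<F>. z F)"
    using continuous_attains_inf[OF cC _ continuous_on_subset[OF contp subset_UNIV]] by blast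
  show ?thesis
  proof (rule that)
    have "y F \<in> I F" for F using y(1) by (auto simp: C_def K_def)
    then have "y F \<ge> 0" if "F \<in> \<F>" for F
      using that by (metis I_def atLeastAtMost_iff)
    then show "fractional_cover \<F> S y"
      using y(1) by (auto simp: fractional_cover_def C_def)
    fix z assume z: "fractional_cover \<F> S z"
    have "(\<Sum>F\<in>\<F>. y F) \<le> (\<Sum>F\<in>\<F>. if F \<in> \<F> then min 1 (z F) else 0)"
      using y(2) trunc[OF z] by blast
    also have "\<dots> \<le> (\<Sum>F\<in>\<F>. z F)" by (intro sum_mono) auto
    finally show "(\<Sum>F\<in>\<F>. y F) \<le> (\<Sum>F\<in>\<F>. z F)" .
  qed
qed

lemma fcov_attained:
  assumes "finite \<F>" and "S \<subseteq> \<Union>\<F>"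
  shows "\<exists>y. fractional_cover \<F> S y \<and> fcov \<F> S = (\<Sum>F\<in>\<F>. y F)"
    and "fractional_cover \<F> S z \<Longrightarrow> fcov \<F> S \<le> (\<Sum>F\<in>\<F>. z F)"
proof -
  obtain y where y: "fractional_cover \<F> S y"
    "\<And>z. fractional_cover \<F> S z \<Longrightarrow> (\<Sum>F\<in>\<F>. y F) \<le> (\<Sum>F\<in>\<F>. z F)"
    using fractional_cover_min_exists[OF assms] by metis
  have eq: "fcov \<F> S = (\<Sum>F\<in>\<F>. y F)"
    unfolding fcov_def by (rule Least_equality) (use y in auto)
  show "\<exists>y. fractional_cover \<F> S y \<and> fcov \<F> S = (\<Sum>F\<in>\<F>. y F)"
    using eq y(1) by blast
  show "fractional_cover \<F> S z \<Longrightarrow> fcov \<F> S \<le> (\<Sum>F\<in>\<F>. z F)"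
    using eq y(2) by simp
qed

lemma finite_layered_family:
  assumes "pair_graph G"
  shows "finite (layered_family G \<L>)"
proof -
  interpret pair_graph G by fact
  have "layered_family G \<L> \<subseteq>
      (\<lambda>u. insert u (descendants (layer_digraph G \<L>) u)) ` pverts G"
    by (auto simp: layered_family_def)
  then show ?thesis
    using finite_verts by (meson finite_imageI finite_subset)
qed

lemma Union_layered_family:
  assumes G: "pair_graph G" and \<L>: "ordered_partition (pverts G) \<L>"
  shows "\<Union>(layered_family G \<L>) = pverts G"
proof
  interpret pair_graph G by fact
  define D where "D = layer_digraph G \<L>"
  have pvD: "pverts D = pverts G" by (simp add: D_def layer_digraph_def)
  have "pair_wf_digraph D"
    by unfold_locales
      (auto simp: D_def layer_digraph_def dest: in_arcsD1 in_arcsD2)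
  then interpret D: pair_wf_digraph D .
  have desc: "descendants D u = {v. u \<rightarrow>\<^sup>*\<^bsub>with_proj D\<^esub> v}" for u
    by (auto simp: descendants_def D.reachable_vpath_conv)
  have "descendants D u \<subseteq> pverts G" for u
    using pvD by (auto simp: descendants_def vpath_def vwalk_def)
  then show "\<Union>(layered_family G \<L>) \<subseteq> pverts G"
    unfolding layered_family_def D_def[symmetric] by blast
  have source: "\<exists>u. u \<in> pverts G \<and> in_arcs (with_proj D) u = {} \<and> u \<rightarrow>\<^sup>*\<^bsub>with_proj D\<^esub> v"
    if "i < length \<L>" "v \<in> \<L> ! i" "v \<in> pverts G" for i v
    using that
  proof (induction "length \<L> - i" arbitrary: i v rule: less_induct)
    case less
    show ?case
    proof (cases "in_arcs (with_proj D) v = {}")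
      case True
      then show ?thesis using less.prems pvD D.reachable_refl[of v] by blast
    next
      case False
      then obtain w where w: "(w, v) \<in> parcs D" by (auto simp: in_arcs_def)
      then obtain a b where ab: "b < a" "a < length \<L>" "w \<in> \<L> ! a" "v \<in> \<L> ! b"
        by (auto simp: D_def layer_digraph_def)
      have bl: "b < length \<L>" using ab by simp
      have "disjoint (set \<L>)" "distinct \<L>"
        using \<L> by (auto simp: ordered_partition_def partition_on_def)
      then have "\<L> ! b = \<L> ! i"
        using ab(4) less.prems(2) nth_mem[OF bl] nth_mem[OF less.prems(1)]
        by (auto simp: disjoint_def)
      then have "b = i"
        using \<open>distinct \<L>\<close> bl less.prems(1) nth_eq_iff_index_eq by blast
      moreover have "w \<in> pverts G" using w D.in_arcsD1 pvD by auto
      moreover have "length \<L> - a < length \<L> - i"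
        using \<open>b = i\<close> ab less.prems(1) by (simp add: diff_less_mono2)
      ultimately obtain u where u: "u \<in> pverts G" "in_arcs (with_proj D) u = {}"
        "u \<rightarrow>\<^sup>*\<^bsub>with_proj D\<^esub> w"
        using less.hyps[of a w] ab by blast
      have "u \<rightarrow>\<^sup>*\<^bsub>with_proj D\<^esub> v"
        by (rule D.reachable_adj_trans[OF u(3)]) (simp add: w)
      then show ?thesis using u by blast
    qed
  qed
  show "pverts G \<subseteq> \<Union>(layered_family G \<L>)"
  proof
    fix v assume v: "v \<in> pverts G"
    then have "v \<in> \<Union>(set \<L>)"
      using \<L> by (simp add: ordered_partition_def partition_on_def)
    then obtain L where L: "L \<in> set \<L>" "v \<in> L" by (rule UnionE)
    from L(1) obtain i where "i < length \<L>" "\<L> ! i = L"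
      unfolding in_set_conv_nth by (elim exE conjE)
    with L(2) have i: "i < length \<L>" "v \<in> \<L> ! i" by simp_all
    from source[OF i v] obtain u where u: "u \<in> pverts G" "in_arcs (with_proj D) u = {}"
      "v \<in> descendants D u"
      unfolding desc by blast
    then have "insert u (descendants D u) \<in> layered_family G \<L>"
      unfolding layered_family_def D_def by blast
    then show "v \<in> \<Union>(layered_family G \<L>)"
      using u(3) by blast
  qed
qed

end

theory Submission
  imports Defs
begin

text \<open>
  Give a vertex \<open>v\<close> the weight \<open>w v\<close>, the sum of all \<open>x F\<close> with \<open>v \<in> F\<close>, and discard weights below
  \<open>1 / (2 n)\<close>; every \<open>A\<close>--\<open>B\<close> walk still has length at least \<open>1/2\<close>.  The boundary \<open>S\<close> of the ball
  of radius \<open>\<theta>\<close> around \<open>A\<close> is a separator for each \<open>\<theta>\<close> in \<open>(0, 1/2]\<close>.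

  Members of the family are closed under descendants, so \<open>w\<close> is monotone along a descent from the
  center of \<open>F\<close> to \<open>v \<in> F\<close>, which has at most \<open>k\<close> vertices.  Hence all vertices of \<open>F\<close> of weight at
  most \<open>2^-i\<close> are within \<open>k 2^-i\<close> of the center, and \<open>F\<close> can meet \<open>S\<close> in a vertex of weight about
  \<open>2^-i\<close> only if \<open>\<theta>\<close> lies in an interval of length \<open>2 k 2^-i\<close>.  In that case charge
  \<open>2^(i+1) x F\<close> to \<open>F\<close>.  These charges cover \<open>S\<close>, and averaged over \<open>\<theta>\<close> they cost \<open>8 k x F\<close> for each
  of the scales \<open>2 \<le> i \<le> log 2n\<close>; weights of at least \<open>1/4\<close> are paid for by an unconditional \<open>4 x F\<close>.
\<close>

section \<open>Union bound, walks and induced paths\<close>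

lemma sum_UN_le:
  fixes f :: "'b \<Rightarrow> real"
  assumes "finite I" and "\<And>i. i \<in> I \<Longrightarrow> finite (C i)"
    and "\<And>i a. \<lbrakk>i \<in> I; a \<in> C i\<rbrakk> \<Longrightarrow> 0 \<le> f a"
  shows "sum f (\<Union>i\<in>I. C i) \<le> (\<Sum>i\<in>I. sum f (C i))"
  using assms
proof (induction I rule: finite_induct)
  case (insert i I)
  have "0 \<le> sum f (C i \<inter> (\<Union>i\<in>I. C i))" using insert.prems(2) by (intro sum_nonneg) auto
  moreover have "sum f (C i \<union> (\<Union>i\<in>I. C i))
      = sum f (C i) + sum f (\<Union>i\<in>I. C i) - sum f (C i \<inter> (\<Union>i\<in>I. C i))"
    using insert by (intro sum_Un) auto
  moreover have "sum f (\<Union>i\<in>I. C i) \<le> (\<Sum>i\<in>I. sum f (C i))"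
    using insert.IH insert.prems by blast
  ultimately show ?case using insert.hyps by simp
qed simp

lemma vwalk_with_proj_iff:
  "vwalk p (with_proj G) \<longleftrightarrow>
     p \<noteq> [] \<and> set p \<subseteq> pverts G \<and> successively (\<lambda>u v. (u, v) \<in> parcs G) p"
proof -
  have "set (vwalk_arcs p) \<subseteq> parcs G \<longleftrightarrow> successively (\<lambda>u v. (u, v) \<in> parcs G) p"
    by (induction p rule: vwalk_arcs.induct) auto
  then show ?thesis by (auto simp: vwalk_def)
qed

lemma vwalk_shortcut:
  assumes p: "vwalk p (with_proj G)" and ij: "i < j" "j < length p"
    and e: "(p ! i, p ! j) \<in> parcs G"
  shows "vwalk (take (Suc i) p @ drop j p) (with_proj G)"
    and "hd (take (Suc i) p @ drop j p) = hd p"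
    and "last (take (Suc i) p @ drop j p) = last p"
    and "set (take (Suc i) p @ drop j p) \<subseteq> set p"
proof -
  let ?E = "\<lambda>u v. (u, v) \<in> parcs G"
  have s: "successively ?E p" using p by (simp add: vwalk_with_proj_iff)
  have s1: "successively ?E (take (Suc i) p)" and s2: "successively ?E (drop j p)"
    using s successively_append_iff[of ?E "take (Suc i) p" "drop (Suc i) p"]
      successively_append_iff[of ?E "take j p" "drop j p"] by simp_all
  have "last (take (Suc i) p) = p ! i" using ij by (simp add: take_Suc_conv_app_nth)
  moreover have "hd (drop j p) = p ! j" using ij by (simp add: hd_drop_conv_nth)
  ultimately have "successively ?E (take (Suc i) p @ drop j p)"
    using s1 s2 e by (simp add: successively_append_iff)
  moreover show sub: "set (take (Suc i) p @ drop j p) \<subseteq> set p"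
    by (auto dest: in_set_takeD in_set_dropD)
  ultimately show "vwalk (take (Suc i) p @ drop j p) (with_proj G)"
    using p ij unfolding vwalk_with_proj_iff by auto
  show "hd (take (Suc i) p @ drop j p) = hd p" using ij by (cases p) auto
  show "last (take (Suc i) p @ drop j p) = last p" using ij by simp
qed

lemma vwalk_cut_cycle:
  assumes p: "vwalk p (with_proj G)" and ij: "i < j" "j < length p" and e: "p ! i = p ! j"
  shows "vwalk (take i p @ drop j p) (with_proj G)"
    and "hd (take i p @ drop j p) = hd p"
    and "last (take i p @ drop j p) = last p"
    and "set (take i p @ drop j p) \<subseteq> set p"
proof -
  let ?E = "\<lambda>u v. (u, v) \<in> parcs G"
  have hj: "hd (drop j p) = p ! i" using ij e by (simp add: hd_drop_conv_nth)
  have s: "successively ?E p" using p by (simp add: vwalk_with_proj_iff)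
  have s0: "successively ?E (take i p @ drop i p)" using s by simp
  have s2: "successively ?E (drop j p)"
    using s successively_append_iff[of ?E "take j p" "drop j p"] by simp
  have "hd (drop i p) = p ! i" using ij by (simp add: hd_drop_conv_nth)
  then have "successively ?E (take i p @ drop j p)"
    using s0 s2 hj ij unfolding successively_append_iff by auto
  moreover show "set (take i p @ drop j p) \<subseteq> set p"
    by (auto dest: in_set_takeD in_set_dropD)
  ultimately show "vwalk (take i p @ drop j p) (with_proj G)"
    using p ij unfolding vwalk_with_proj_iff by auto
  \<comment> \<open>For \<open>i = 0\<close> the first piece is empty, so the new head is
    \<open>p ! j\<close>, which equals \<open>p ! 0\<close>.\<close>
  show "hd (take i p @ drop j p) = hd p"
  proof (cases i)
    case 0
    then show ?thesis using hj hd_conv_nth[of p] ij by fastforce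
  next
    case (Suc i')
    then show ?thesis using ij by (cases p) auto
  qed
  show "last (take i p @ drop j p) = last p" using ij by simp
qed

text \<open>Induction on the length: a walk that is not an induced path repeats a vertex or has a
  chord between non-consecutive positions, and cutting there gives a strictly shorter walk with the
  same ends. This carries the LP constraints, imposed on induced paths only, over to all
  walks.\<close>

lemma induced_AB_path_in_vwalk:
  assumes "vwalk p (with_proj G)" "hd p \<in> A" "last p \<in> B"
  obtains q where "induced_AB_path G A B q" "set q \<subseteq> set p"
proof -
  have "\<exists>q. induced_AB_path G A B q \<and> set q \<subseteq> set p"
    using assms
  proof (induction p rule: length_induct)
    case (1 p)
    have smaller: ?case if "vwalk q (with_proj G)" "hd q = hd p" "last q = last p"
      "set q \<subseteq> set p" "length q < length p" for q
      using 1 that by (metis subset_trans)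
    show ?case
    proof (cases "distinct p")
      case False
      then obtain i j where "i < j" "j < length p" "p ! i = p ! j"
        by (metis distinct_conv_nth linorder_neqE_nat)
      then show ?thesis
        using vwalk_cut_cycle[OF 1(2), of i j] by (intro smaller[of "take i p @ drop j p"]) auto
    next
      case True
      show ?thesis
      proof (cases "induced_AB_path G A B p")
        case False
        then obtain i j where "i < j" "j < length p" "(p ! i, p ! j) \<in> parcs G" "j \<noteq> Suc i"
          using 1(2-) True by (auto simp: induced_AB_path_def AB_path_def vpath_def)
        then show ?thesis
          using vwalk_shortcut[OF 1(2), of i j]
          by (intro smaller[of "take (Suc i) p @ drop j p"]) auto
      qed blast
    qed
  qed
  then show ?thesis using that by blast
qed

section \<open>Vertex-weighted distance from \<open>A\<close>\<close>

text \<open>The cap \<open>1/2\<close> keeps the distance finite for vertices that cannot be reached from \<open>A\<close>.\<close>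

definition capped_dist :: "'a pair_pre_digraph \<Rightarrow> 'a set \<Rightarrow> ('a \<Rightarrow> real) \<Rightarrow> 'a \<Rightarrow> real" where
  "capped_dist G A c v = Inf (insert (1/2)
     {sum_list (map c p) | p. vwalk p (with_proj G) \<and> hd p \<in> A \<and> last p = v})"

context
  fixes G :: "'a pair_pre_digraph" and A :: "'a set" and c :: "'a \<Rightarrow> real"
  assumes c_nonneg: "\<And>v. 0 \<le> c v"
begin

lemma capped_dist_le_half: "capped_dist G A c v \<le> 1/2"
  and capped_dist_le_vwalk:
    "\<lbrakk>vwalk p (with_proj G); hd p \<in> A; last p = v\<rbrakk> \<Longrightarrow> capped_dist G A c v \<le> sum_list (map c p)"
proof -
  have bdd: "bdd_below (insert (1/2)
      {sum_list (map c p) | p. vwalk p (with_proj G) \<and> hd p \<in> A \<and> last p = v})"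
    by (rule bdd_belowI[of _ 0]) (auto intro!: sum_list_nonneg c_nonneg)
  show "capped_dist G A c v \<le> 1/2"
    unfolding capped_dist_def by (rule cInf_lower[OF _ bdd]) simp
  show "capped_dist G A c v \<le> sum_list (map c p)"
    if "vwalk p (with_proj G)" "hd p \<in> A" "last p = v"
    unfolding capped_dist_def by (rule cInf_lower[OF _ bdd]) (use that in blast)
qed

lemma capped_dist_source: "v \<in> A \<Longrightarrow> v \<in> pverts G \<Longrightarrow> capped_dist G A c v \<le> c v"
  using capped_dist_le_vwalk[of "[v]" v] by (simp add: vwalk_with_proj_iff)

text \<open>Appending \<open>v\<close> to a walk that ends in \<open>u\<close> costs
  \<open>c v\<close>, the weight of the vertex entered. If the value at \<open>u\<close> comes from
  the cap, the bound holds because the value at \<open>v\<close> is capped as well.\<close>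

lemma capped_dist_arc:
  assumes uv: "(u, v) \<in> parcs G" and v: "v \<in> pverts G"
  shows "capped_dist G A c v \<le> capped_dist G A c u + c v"
proof -
  have "capped_dist G A c v - c v \<le> capped_dist G A c u"
    unfolding capped_dist_def[of _ _ _ u]
  proof (rule cInf_greatest)
    fix z
    assume "z \<in> insert (1/2)
      {sum_list (map c p) | p. vwalk p (with_proj G) \<and> hd p \<in> A \<and> last p = u}"
    then consider "z = 1/2" | p where "z = sum_list (map c p)" "vwalk p (with_proj G)"
      "hd p \<in> A" "last p = u" by blast
    then show "capped_dist G A c v - c v \<le> z"
    proof cases
      case 1
      then show ?thesis using capped_dist_le_half[of v] c_nonneg[of v] by linarith
    next
      case 2
      have "vwalk (p @ [v]) (with_proj G)"
        using 2 uv v by (auto simp: vwalk_with_proj_iff successively_append_iff)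
      moreover have "hd (p @ [v]) \<in> A" using 2 by (auto simp: vwalk_with_proj_iff)
      ultimately show ?thesis using capped_dist_le_vwalk[of "p @ [v]" v] 2 by simp
    qed
  qed blast
  then show ?thesis by simp
qed

text \<open>Edges can be traversed both ways, so each one changes the distance by at most
  \<open>W\<close> in either direction. The factor counts edges, one fewer than vertices; the
  multiple of \<open>W\<close> saved here is spent later.\<close>

lemma capped_dist_vwalk_le:
  assumes G: "pair_graph G" and p: "vwalk p (with_proj G)" and W: "\<And>z. z \<in> set p \<Longrightarrow> c z \<le> W"
  shows "\<bar>capped_dist G A c (last p) - capped_dist G A c (hd p)\<bar> \<le> real (length p - 1) * W"
  using p W
proof (induction p rule: induct_list012)
  case (3 u v p)
  interpret pair_graph G by fact
  have uv: "(u, v) \<in> parcs G" and walk: "vwalk (v # p) (with_proj G)"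
    using 3(3) by (auto simp: vwalk_with_proj_iff)
  have vu: "(v, u) \<in> parcs G" using uv by (simp add: graph_symmetric)
  have "u \<in> pverts G" "v \<in> pverts G" using uv in_arcsD1 in_arcsD2 by auto
  then have "\<bar>capped_dist G A c u - capped_dist G A c v\<bar> \<le> W"
    using capped_dist_arc[OF uv] capped_dist_arc[OF vu] 3(4)[of u] 3(4)[of v] by force
  moreover have "\<bar>capped_dist G A c (last (v # p)) - capped_dist G A c v\<bar> \<le> real (length p) * W"
    using 3(2)[OF walk] 3(4) by simp
  ultimately show ?case by (simp add: algebra_simps)
qed (auto simp: vwalk_with_proj_iff)

text \<open>The first vertex of a path at distance at least \<open>\<theta>\<close> lies in the
  boundary: either its predecessor is closer than \<open>\<theta>\<close>, or it is the start and
  its distance is at most its own weight. Such a vertex exists because the end of the path lies in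
  \<open>B\<close>.\<close>

lemma capped_dist_ball_boundary_separates:
  assumes A: "A \<subseteq> pverts G"
    and far: "\<And>b. b \<in> B \<Longrightarrow> 1/2 \<le> capped_dist G A c b"
    and \<theta>: "0 < \<theta>" "\<theta> \<le> 1/2"
  shows "AB_separator G A B
    {v \<in> pverts G. capped_dist G A c v - c v < \<theta> \<and> \<theta> \<le> capped_dist G A c v}"
    (is "AB_separator G A B ?S")
  unfolding AB_separator_def
proof (intro conjI allI impI)
  let ?d = "capped_dist G A c"
  fix p assume p: "AB_path G A B p"
  then have walk: "vwalk p (with_proj G)" and ends: "hd p \<in> A" "last p \<in> B"
    by (auto simp: AB_path_def vpath_def)
  have ne: "p \<noteq> []" and sub: "set p \<subseteq> pverts G"
    and succ: "successively (\<lambda>u v. (u, v) \<in> parcs G) p"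
    using walk by (auto simp: vwalk_with_proj_iff)
  define P where "P i \<longleftrightarrow> i < length p \<and> \<theta> \<le> ?d (p ! i)" for i
  have "P (length p - 1)"
    using far[OF ends(2)] \<theta> ne by (simp add: P_def last_conv_nth)
  then have least: "P (LEAST i. P i)" by (rule LeastI)
  define i where "i = (LEAST i. P i)"
  have i: "i < length p" "\<theta> \<le> ?d (p ! i)" using least by (auto simp: P_def i_def)
  have pv: "p ! i \<in> pverts G" using i(1) sub nth_mem by blast
  have "?d (p ! i) - c (p ! i) < \<theta>"
  proof (cases i)
    case 0
    then show ?thesis
      using capped_dist_source[of "p ! i"] ends(1) ne pv \<theta> by (simp add: hd_conv_nth)
  next
    case (Suc j)
    have "\<not> P j" using Suc not_less_Least[of j P] by (simp add: i_def)
    then have "?d (p ! j) < \<theta>" using Suc i(1) by (simp add: P_def)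
    moreover have "(p ! j, p ! i) \<in> parcs G"
      using successively_nth[OF succ] Suc i(1) by blast
    then have "?d (p ! i) \<le> ?d (p ! j) + c (p ! i)" using pv by (rule capped_dist_arc)
    ultimately show ?thesis by simp
  qed
  then have "p ! i \<in> ?S" using pv i by simp
  then show "set p \<inter> ?S \<noteq> {}" using i(1) nth_mem by blast
qed blast

end

text \<open>Every walk from \<open>A\<close> to \<open>b\<close> contains the vertices of an induced
  path, whose weights already sum to at least 1/2; the cap itself equals 1/2.\<close>

lemma capped_dist_target:
  assumes c: "\<And>v. 0 \<le> c v"
    and ind: "\<And>q. induced_AB_path G A B q \<Longrightarrow> 1/2 \<le> sum c (set q)" and b: "b \<in> B"
  shows "1/2 \<le> capped_dist G A c b"
  unfolding capped_dist_def
proof (rule cInf_greatest)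
  fix z
  assume "z \<in> insert (1/2)
    {sum_list (map c p) | p. vwalk p (with_proj G) \<and> hd p \<in> A \<and> last p = b}"
  then consider "z = 1/2" | p where "z = sum_list (map c p)" "vwalk p (with_proj G)"
    "hd p \<in> A" "last p = b" by blast
  then show "1/2 \<le> z"
  proof cases
    case 2
    then obtain q where q: "induced_AB_path G A B q" "set q \<subseteq> set p"
      using b induced_AB_path_in_vwalk by metis
    have "1/2 \<le> sum c (set q)" using ind q by blast
    also have "\<dots> \<le> sum c (set p)" using q c by (intro sum_mono2) auto
    \<comment> \<open>A repeated vertex counts once in the set and at each occurrence in the
      list.\<close>
    also have "\<dots> \<le> sum_list (map c p)"
    proof (induction p)
      case (Cons a p)
      then show ?case using c[of a] by (cases "a \<in> set p") (auto simp: insert_absorb)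
    qed simp
    finally show ?thesis using 2 by simp
  qed simp
qed blast

section \<open>Descents in the layer digraph\<close>

text \<open>The index of the part drops strictly along every arc, hence by transitivity along the
  whole path, so no part contains two of its vertices.\<close>

lemma length_vpath_layer_digraph_le:
  assumes L: "ordered_partition (pverts G) \<L>" and p: "vpath p (with_proj (layer_digraph G \<L>))"
  shows "length p \<le> card {L \<in> set \<L>. set p \<inter> L \<noteq> {}}"
proof -
  have disj: "disjoint (set \<L>)" and dist: "distinct \<L>" and cov: "\<Union>(set \<L>) = pverts G"
    using L by (auto simp: ordered_partition_def partition_on_def)
  have uniq: "i = j" if "i < length \<L>" "j < length \<L>" "v \<in> \<L> ! i" "v \<in> \<L> ! j" for i j v
  proof -
    have "\<L> ! i = \<L> ! j"
      using disj that nth_mem[OF that(1)] nth_mem[OF that(2)] unfolding disjoint_def by blast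
    then show ?thesis using dist that nth_eq_iff_index_eq by blast
  qed
  define r where "r v = (SOME i. i < length \<L> \<and> v \<in> \<L> ! i)" for v
  have r: "r v < length \<L> \<and> v \<in> \<L> ! r v" if "v \<in> pverts G" for v
  proof -
    have "\<exists>i. i < length \<L> \<and> v \<in> \<L> ! i" using that unfolding cov[symmetric]
      by (metis UnionE in_set_conv_nth)
    then show ?thesis unfolding r_def by (rule someI_ex)
  qed
  have sub: "set p \<subseteq> pverts G"
    and succ: "successively (\<lambda>u v. (u, v) \<in> parcs (layer_digraph G \<L>)) p"
    using p by (auto simp: vpath_def vwalk_with_proj_iff layer_digraph_def)
  have "successively (\<lambda>u v. r v < r u) p"
    using succ
  proof (rule successively_mono)
    fix u v assume uv: "u \<in> set p" "v \<in> set p" "(u, v) \<in> parcs (layer_digraph G \<L>)"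
    then obtain i j where ij: "j < i" "i < length \<L>" "u \<in> \<L> ! i" "v \<in> \<L> ! j"
      by (auto simp: layer_digraph_def)
    then have "r u = i" "r v = j"
      using uniq[of "r u" i u] uniq[of "r v" j v] r uv(1,2) sub by auto
    then show "r v < r u" using ij by simp
  qed
  then have "sorted_wrt (>) (map r p)"
    by (simp add: successively_map flip: successively_conv_sorted_wrt[OF transp_on_greater])
  then have "distinct (map r p)"
    by (simp add: sorted_wrt_iff_nth_less distinct_conv_nth) (metis linorder_neqE_nat less_irrefl)
  then have inj: "inj_on r (set p)" and dp: "distinct p" by (auto simp: distinct_map)
  have "inj_on (\<lambda>v. \<L> ! r v) (set p)"
  proof (rule inj_onI)
    fix u v assume "u \<in> set p" "v \<in> set p" "\<L> ! r u = \<L> ! r v"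
    then show "u = v" using dist r sub inj by (metis inj_onD nth_eq_iff_index_eq subsetD)
  qed
  moreover have "(\<lambda>v. \<L> ! r v) ` set p \<subseteq> {L \<in> set \<L>. set p \<inter> L \<noteq> {}}"
    using r sub by fastforce
  ultimately have "card (set p) \<le> card {L \<in> set \<L>. set p \<inter> L \<noteq> {}}"
    by (intro card_inj_on_le) auto
  then show ?thesis using dp by (simp add: distinct_card)
qed

text \<open>The total number of parts is an admissible bound, so the minimum defining
  \<open>thickness\<close> is attained.\<close>

lemma card_meets_le_thickness:
  assumes "F \<in> \<F>"
  shows "card {L \<in> set \<L>. F \<inter> L \<noteq> {}} \<le> thickness \<L> \<F>"
proof -
  have "\<exists>k. \<forall>F\<in>\<F>. card {L \<in> set \<L>. F \<inter> L \<noteq> {}} \<le> k"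
    by (intro exI[of _ "card (set \<L>)"] ballI card_mono) auto
  then have "\<forall>F\<in>\<F>. card {L \<in> set \<L>. F \<inter> L \<noteq> {}} \<le> thickness \<L> \<F>"
    unfolding thickness_def by (rule LeastI_ex)
  then show ?thesis using assms by blast
qed

lemma last_in_descendants:
  assumes "vpath p (with_proj D)" "z \<in> set p"
  shows "last p \<in> descendants D z"
proof -
  obtain xs ys where p: "p = xs @ z # ys" using assms(2) by (meson split_list)
  then have "vpath (z # ys) (with_proj D)"
    using assms(1) by (auto simp: vpath_def vwalk_with_proj_iff successively_append_iff)
  then show ?thesis unfolding descendants_def p by force
qed

text \<open>Transitivity of reachability. Consequently a vertex lies in every member that contains
  one of its ancestors, which makes weights monotone along descents.\<close>

lemma layered_family_descendants_closed:
  assumes G: "pair_graph G" and F: "F \<in> layered_family G \<L>" and z: "z \<in> F"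
  shows "descendants (layer_digraph G \<L>) z \<subseteq> F"
proof -
  interpret pair_graph G by fact
  define D where "D = layer_digraph G \<L>"
  have pvD: "pverts D = pverts G" by (simp add: D_def layer_digraph_def)
  interpret D: pair_wf_digraph D
    by unfold_locales (auto simp: D_def layer_digraph_def dest: in_arcsD1 in_arcsD2)
  have desc: "descendants D u = {v. u \<rightarrow>\<^sup>*\<^bsub>with_proj D\<^esub> v}" for u
    by (auto simp: descendants_def D.reachable_vpath_conv)
  obtain u where u: "u \<in> pverts G" "F = insert u (descendants D u)"
    using F by (auto simp: layered_family_def D_def)
  have "u \<rightarrow>\<^sup>*\<^bsub>with_proj D\<^esub> z" using z u pvD by (auto simp: desc)
  then show ?thesis
    using u(2) D.reachable_trans unfolding D_def[symmetric] desc by blast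
qed

section \<open>Averaging over the radius and dyadic scales\<close>

text \<open>The interval around \<open>a j\<close> has length \<open>2 * r j\<close>, so the
  right-hand side is the integral of the weighted count of intervals over the line. A point of
  \<open>{0<..l}\<close> where the count is smallest therefore works.\<close>

lemma exists_point_in_few_intervals:
  fixes c a r :: "'j \<Rightarrow> real"
  assumes J: "finite J" and c: "\<And>j. j \<in> J \<Longrightarrow> 0 \<le> c j" and r: "\<And>j. j \<in> J \<Longrightarrow> 0 \<le> r j"
    and l: "0 < l"
  obtains \<theta> where "0 < \<theta>" "\<theta> \<le> l"
    "l * (\<Sum>j\<in>J. c j * indicator {a j - r j..a j + r j} \<theta>) \<le> (\<Sum>j\<in>J. c j * (2 * r j))"
proof -
  define g where "g \<theta> = (\<Sum>j\<in>J. c j * indicator {a j - r j..a j + r j} \<theta>)" for \<theta>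
  \<comment> \<open>Each value of \<open>g\<close> is a subset sum of \<open>c\<close>, so
    \<open>g\<close> has finitely many values and attains its minimum.\<close>
  have "g \<theta> = sum c {j \<in> J. \<theta> \<in> {a j - r j..a j + r j}}" for \<theta>
    unfolding g_def using J by (intro sum.mono_neutral_cong_right) (auto simp: indicator_def)
  then have "g ` {0<..l} \<subseteq> sum c ` Pow J" by auto
  then have fin: "finite (g ` {0<..l})" using J by (meson finite_Pow_iff finite_imageI finite_subset)
  moreover have ne: "g ` {0<..l} \<noteq> {}" using l by auto
  ultimately obtain \<theta> where \<theta>: "\<theta> \<in> {0<..l}" "g \<theta> = Min (g ` {0<..l})"
    using Min_in by (metis imageE)
  have min: "g \<theta> \<le> g t" if "t \<in> {0<..l}" for t using \<theta> fin that by simp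
  have g0: "0 \<le> g t" for t unfolding g_def by (intro sum_nonneg mult_nonneg_nonneg c) auto
  \<comment> \<open>As \<open>g\<close> is nonnegative, intervals reaching outside
    \<open>{0<..l}\<close> only enlarge the right-hand side.\<close>
  have "integral\<^sup>L lborel (\<lambda>t. g \<theta> * indicator {0<..l} t) \<le> integral\<^sup>L lborel g"
  proof (rule integral_mono)
    show "integrable lborel (\<lambda>t. g \<theta> * indicator {0<..l} t)"
      using l by (intro integrable_mult_right integrable_real_indicator) auto
    show "integrable lborel g"
      unfolding g_def
      by (intro Bochner_Integration.integrable_sum integrable_mult_right integrable_real_indicator)
        (auto simp: emeasure_lborel_Icc_eq)
    show "g \<theta> * indicator {0<..l} t \<le> g t" for t
      using min[of t] g0[of t] by (auto simp: indicator_def)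
  qed
  moreover have "integral\<^sup>L lborel (\<lambda>t. g \<theta> * indicator {0<..l} t) = l * g \<theta>"
    using l by simp
  moreover have "integral\<^sup>L lborel g = (\<Sum>j\<in>J. c j * (2 * r j))"
    unfolding g_def
    by (subst Bochner_Integration.integral_sum)
      (auto intro!: sum.cong integrable_mult_right integrable_real_indicator
        simp: emeasure_lborel_Icc_eq r)
  ultimately show ?thesis using that[of \<theta>] \<theta>(1) by (simp add: g_def mult.commute)
qed

text \<open>Rounding \<open>log 2 (1 / w)\<close> down places \<open>w\<close> between
  \<open>1 / 2 ^ Suc i\<close> and \<open>1 / 2 ^ i\<close>. The bound \<open>w < 1/4\<close> gives
  \<open>2 \<le> i\<close>, and the lower bound on \<open>w\<close> gives the upper bound on
  \<open>i\<close>.\<close>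

lemma dyadic_scale:
  fixes w :: real
  assumes n: "0 < n" and "0 < w" "w < 1/4" "1 / (2 * real n) \<le> w"
  obtains i :: nat where "2 \<le> i" "i \<le> nat \<lfloor>log 2 (2 * real n)\<rfloor>" "w \<le> 1 / 2 ^ i" "1 \<le> 2 ^ Suc i * w"
proof -
  define i where "i = nat \<lfloor>log 2 (1 / w)\<rfloor>"
  have "log 2 (2 ^ 2) \<le> log 2 (1 / w)"
    using assms by (subst log_le_cancel_iff) (auto simp: field_simps)
  then have l2: "2 \<le> log 2 (1 / w)" by (subst (asm) log_pow_cancel) auto
  then have i2: "2 \<le> i" unfolding i_def by linarith
  have il: "real i \<le> log 2 (1 / w)" "log 2 (1 / w) < real i + 1"
    using l2 unfolding i_def by linarith+
  have "2 ^ i \<le> 1 / w" using il(1) assms by (simp add: le_log_iff powr_realpow)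
  then have a: "w \<le> 1 / 2 ^ i" using assms by (simp add: field_simps)
  have "1 / w < 2 powr (real i + 1)" using il(2) assms by (subst (asm) log_less_iff) auto
  also have "\<dots> = 2 ^ Suc i" using powr_realpow[of "2::real" "Suc i"] by (simp add: add.commute)
  finally have b: "1 \<le> 2 ^ Suc i * w" using assms by (simp add: field_simps)
  have "1 / w \<le> 2 * real n" using assms n by (simp add: field_simps)
  then have "log 2 (1 / w) \<le> log 2 (2 * real n)" using assms n by (subst log_le_cancel_iff) auto
  then have "i \<le> nat \<lfloor>log 2 (2 * real n)\<rfloor>"
    unfolding i_def by (intro nat_mono floor_mono)
  with i2 a b show ?thesis using that by blast
qed

section \<open>The separator and its fractional cover\<close>

theorem theorem4p1:
  fixes G :: "'a pair_pre_digraph"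
    and n k :: nat
    and \<L> :: "'a set list"
    and \<F> :: "'a set set"
    and A B :: "'a set"
    and x :: "'a set \<Rightarrow> real"
  assumes "pair_graph G"
    and "card (pverts G) = n"
    and "k > 0"
    and "ordered_partition (pverts G) \<L>"
    and "\<F> = layered_family G \<L>"
    and "thickness \<L> \<F> \<le> k"
    and "A \<subseteq> pverts G" and "B \<subseteq> pverts G"
    and "separator_LP_optimal G \<F> A B x"
  shows "\<exists>S. AB_separator G A B S \<and>
           fcov \<F> S \<le> 8 * real k * log 2 (2 * real n) * (\<Sum>F\<in>\<F>. x F)"
proof -
  interpret pair_graph G by fact
  define D where "D = layer_digraph G \<L>"
  have finF: "finite \<F>" using finite_layered_family assms by blast
  have UF: "\<Union>\<F> = pverts G" using Union_layered_family assms by blast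
  have x0: "\<And>F. F \<in> \<F> \<Longrightarrow> 0 \<le> x F"
    and xP: "\<And>p. induced_AB_path G A B p \<Longrightarrow> 1 \<le> (\<Sum>F\<in>{F \<in> \<F>. F \<inter> set p \<noteq> {}}. x F)"
    using assms(9) by (auto simp: separator_LP_optimal_def separator_LP_feasible_def)
  define X where "X = (\<Sum>F\<in>\<F>. x F)"
  have X0: "0 \<le> X" unfolding X_def by (intro sum_nonneg x0)
  define w where "w v = (\<Sum>F\<in>{F \<in> \<F>. v \<in> F}. x F)" for v
  have w0: "0 \<le> w v" for v unfolding w_def by (intro sum_nonneg) (auto intro: x0)
  define c where "c v = (if 1 / (2 * real n) \<le> w v then w v else 0)" for v
  have c0: "0 \<le> c v" and cw: "c v \<le> w v" for v using w0 by (auto simp: c_def)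
  have finV: "finite (pverts G)" by simp

  have path: "1/2 \<le> sum c (set p)" if p: "induced_AB_path G A B p" for p
  proof -
    have pV: "set p \<subseteq> pverts G" and pne: "p \<noteq> []"
      using p by (auto simp: induced_AB_path_def AB_path_def vpath_def vwalk_with_proj_iff)
    have n: "0 < n" using pV pne assms(2) by (auto simp: card_gt_0_iff)
    have "1 \<le> (\<Sum>F\<in>{F \<in> \<F>. F \<inter> set p \<noteq> {}}. x F)" by (rule xP[OF p])
    \<comment> \<open>A member that meets the path is now counted once for each vertex of the path
      that it contains.\<close>
    also have "\<dots> = sum x (\<Union>v\<in>set p. {F \<in> \<F>. v \<in> F})" by (rule sum.cong) auto
    also have "\<dots> \<le> sum w (set p)"
      unfolding w_def by (rule sum_UN_le) (use finF x0 in auto)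
    \<comment> \<open>Discarding costs at most \<open>1 / (2 n)\<close> per vertex, and the path has
      at most \<open>n\<close> distinct vertices, so at most 1/2 of the total 1 is lost.\<close>
    also have "\<dots> \<le> (\<Sum>v\<in>set p. c v + 1 / (2 * real n))"
      by (intro sum_mono) (auto simp: c_def)
    also have "\<dots> = sum c (set p) + real (card (set p)) / (2 * real n)"
      by (simp add: sum.distrib)
    also have "\<dots> \<le> sum c (set p) + 1/2"
      using card_mono[OF finV pV] assms(2) n by (simp add: field_simps)
    finally show ?thesis by simp
  qed

  define d where "d = capped_dist G A c"
  have far: "1/2 \<le> d b" if "b \<in> B" for b
    unfolding d_def by (rule capped_dist_target[OF c0 path that])

  have "\<exists>u. u \<in> pverts G \<and> F = insert u (descendants D u)" if "F \<in> \<F>" for F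
    using that assms(5) by (auto simp: layered_family_def D_def)
  then obtain cen where cen: "\<And>F. F \<in> \<F> \<Longrightarrow> cen F \<in> pverts G"
    "\<And>F. F \<in> \<F> \<Longrightarrow> F = insert (cen F) (descendants D (cen F))" by metis

  \<comment> \<open>A vertex \<open>v\<close> enters the boundary exactly when
    \<open>d v - c v < \<theta>\<close> and \<open>\<theta> \<le> d v\<close>; these bounds then put
    \<open>\<theta>\<close> within \<open>real k * w v\<close> of \<open>d (cen F)\<close>.\<close>
  have near: "d v \<le> d (cen F) + real k * w v \<and> d (cen F) - real k * w v \<le> d v - c v"
    if F: "F \<in> \<F>" and v: "v \<in> F" for F v
  proof -
    have "v \<in> descendants D (cen F)"
    proof (cases "v = cen F")
      case True
      have "vpath [v] (with_proj D)"
        using True cen(1)[OF F] by (simp add: vpath_def vwalk_with_proj_iff D_def layer_digraph_def)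
      then show ?thesis unfolding descendants_def using True by force
    qed (use v cen(2)[OF F] in auto)
    then obtain p where p: "vpath p (with_proj D)" "hd p = cen F" "last p = v"
      unfolding descendants_def by blast
    have pG: "vwalk p (with_proj G)"
      using p(1) by (auto simp: vpath_def vwalk_with_proj_iff D_def layer_digraph_def
          elim!: successively_mono)
    have le_w: "w z \<le> w v" if z: "z \<in> set p" for z
    proof -
      have "v \<in> descendants D z" using last_in_descendants[OF p(1) z] p(3) by simp
      then have "{F \<in> \<F>. z \<in> F} \<subseteq> {F \<in> \<F>. v \<in> F}"
        using layered_family_descendants_closed[OF assms(1)] assms(5) unfolding D_def by blast
      then show ?thesis unfolding w_def using finF x0 by (intro sum_mono2) auto
    qed
    \<comment> \<open>Prefixes of the path start at the center too, so the path stays in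
      \<open>F\<close> and thickness bounds its length.\<close>
    have pF: "set p \<subseteq> F"
    proof
      fix z assume "z \<in> set p"
      then obtain xs ys where eq: "p = xs @ z # ys" by (meson split_list)
      have "vpath (xs @ [z]) (with_proj D)"
        using p(1) unfolding eq
        by (auto simp: vpath_def vwalk_with_proj_iff successively_append_iff)
      moreover have "hd (xs @ [z]) = cen F" using p(2) unfolding eq by (cases xs) auto
      ultimately have "z \<in> descendants D (cen F)" unfolding descendants_def by force
      then show "z \<in> F" using cen(2)[OF F] by blast
    qed
    have "length p \<le> card {L \<in> set \<L>. set p \<inter> L \<noteq> {}}"
      using length_vpath_layer_digraph_le assms(4) p(1) unfolding D_def by blast
    also have "\<dots> \<le> card {L \<in> set \<L>. F \<inter> L \<noteq> {}}" using pF by (intro card_mono) auto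
    \<comment> \<open>At most \<open>k\<close> vertices means at most \<open>k - 1\<close> edges;
      the remaining multiple of \<open>w v\<close> absorbs the \<open>c v\<close> subtracted in the
      lower bound of \<open>near\<close>.\<close>
    also have "\<dots> \<le> k" using card_meets_le_thickness[OF F] assms(6) by (rule order_trans)
    finally have len: "real (length p - 1) \<le> real k - 1" using \<open>k > 0\<close> by linarith
    have "\<bar>d v - d (cen F)\<bar> \<le> real (length p - 1) * w v"
      using capped_dist_vwalk_le[where c = c and W = "w v" and A = A, OF c0 assms(1) pG]
        order_trans[OF cw le_w] p(2,3) unfolding d_def by simp
    also have "\<dots> \<le> (real k - 1) * w v" using len w0 by (rule mult_right_mono)
    finally show ?thesis using cw[of v] w0[of v] by (simp add: left_diff_distrib) linarith
  qed

  show ?thesis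
  proof (cases "n = 0")
    \<comment> \<open>Without vertices \<open>log 2 (2 n)\<close> is not at least 1, but there are
      no members and no paths either: the empty separator has cover value at most 0.\<close>
    case True
    then have "pverts G = {}" using assms(2) by simp
    then have "\<F> = {}" "A = {}" using assms(5,7) by (auto simp: layered_family_def)
    then have "AB_separator G A B {}" "fcov \<F> {} \<le> 0"
      using fcov_attained(2)[of \<F> "{}" "\<lambda>_. 0"]
      by (auto simp: AB_separator_def AB_path_def fractional_cover_def)
    then show ?thesis using \<open>\<F> = {}\<close> by auto
  next
    case False
    \<comment> \<open>The scales from 2 to \<open>m\<close> number \<open>m - 1\<close>, which is
      none when \<open>n = 1\<close>.\<close>
    define m where "m = nat \<lfloor>log 2 (2 * real n)\<rfloor>"
    have "1 \<le> log 2 (2 * real n)" using False by (simp add: le_log_iff)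
    then have m: "1 \<le> m" "real m \<le> log 2 (2 * real n)" unfolding m_def by linarith+
    define cost where "cost = (\<lambda>(F, i::nat). 2 ^ Suc i * x F)"
    define I :: "real \<Rightarrow> 'a set \<times> nat \<Rightarrow> real" where
      "I \<theta> j = indicator
         {d (cen (fst j)) - real k / 2 ^ snd j..d (cen (fst j)) + real k / 2 ^ snd j} \<theta>"
      for \<theta> j
    have "finite (\<F> \<times> {2..m})" using finF by simp
    moreover have "0 \<le> cost j" if "j \<in> \<F> \<times> {2..m}" for j
      using that x0 by (auto simp: cost_def)
    moreover have "0 \<le> real k / 2 ^ snd j" for j :: "'a set \<times> nat" by simp
    moreover have "(0::real) < 1/2" by simp
    ultimately obtain \<theta> :: real where \<theta>: "0 < \<theta>" "\<theta> \<le> 1/2" and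
      avg: "1/2 * (\<Sum>j\<in>\<F> \<times> {2..m}. cost j * I \<theta> j)
        \<le> (\<Sum>j\<in>\<F> \<times> {2..m}. cost j * (2 * (real k / 2 ^ snd j)))"
      unfolding I_def
      by (rule exists_point_in_few_intervals[where J = "\<F> \<times> {2..m}" and c = cost
          and a = "\<lambda>j. d (cen (fst j))" and r = "\<lambda>j. real k / 2 ^ snd j" and l = "1/2"])
    define S where "S = {v \<in> pverts G. d v - c v < \<theta> \<and> \<theta> \<le> d v}"
    have sep: "AB_separator G A B S"
      unfolding S_def d_def
      by (rule capped_dist_ball_boundary_separates[OF c0 assms(7) _ \<theta>])
        (use far in \<open>simp add: d_def\<close>)
    define y where "y F = 4 * x F + (\<Sum>i\<in>{2..m}. cost (F, i) * I \<theta> (F, i))" for F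
    have term0: "0 \<le> cost (F, i) * I \<theta> (F, i)" if "F \<in> \<F>" for F i
      using x0[OF that] by (simp add: cost_def I_def)
    have cover: "fractional_cover \<F> S y"
      unfolding fractional_cover_def
    proof (intro conjI ballI)
      show "0 \<le> y F" if "F \<in> \<F>" for F
        unfolding y_def using x0[OF that] term0[OF that] by (intro add_nonneg_nonneg sum_nonneg) auto
      fix v assume v: "v \<in> S"
      \<comment> \<open>The strict and the weak inequality in \<open>S\<close> together force
        \<open>c v > 0\<close>, so no vertex of discarded weight needs covering.\<close>
      then have "c v \<noteq> 0" by (auto simp: S_def)
      then have wn: "1 / (2 * real n) \<le> w v" and wpos: "0 < w v"
        using w0[of v] by (auto simp: c_def split: if_splits)
      show "1 \<le> (\<Sum>F\<in>{F \<in> \<F>. v \<in> F}. y F)"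
      proof (cases "w v < 1/4")
        case False
        then have "1 \<le> 4 * w v" by simp
        also have "\<dots> = (\<Sum>F\<in>{F \<in> \<F>. v \<in> F}. 4 * x F)" by (simp add: w_def sum_distrib_left)
        also have "\<dots> \<le> (\<Sum>F\<in>{F \<in> \<F>. v \<in> F}. y F)"
          using term0 by (intro sum_mono) (auto simp: y_def intro!: sum_nonneg)
        finally show ?thesis .
      next
        case True
        obtain i where i: "2 \<le> i" "i \<le> m" "w v \<le> 1 / 2 ^ i" "1 \<le> 2 ^ Suc i * w v"
          using dyadic_scale[OF _ wpos True wn] \<open>n \<noteq> 0\<close> unfolding m_def by blast
        have le: "2 ^ Suc i * x F \<le> y F" if F: "F \<in> \<F>" "v \<in> F" for F
        proof -
          have "real k * w v \<le> real k / 2 ^ i"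
            using mult_left_mono[OF i(3), of "real k"] by simp
          then have "I \<theta> (F, i) = 1"
            using near[OF F] v by (auto simp: I_def S_def)
          then have "2 ^ Suc i * x F = cost (F, i) * I \<theta> (F, i)" by (simp add: cost_def)
          also have "\<dots> \<le> (\<Sum>i\<in>{2..m}. cost (F, i) * I \<theta> (F, i))"
            using i term0[OF F(1)] by (intro member_le_sum) auto
          also have "\<dots> \<le> y F" unfolding y_def using x0[OF F(1)] by simp
          finally show ?thesis .
        qed
        have "1 \<le> 2 ^ Suc i * w v" by (rule i)
        also have "\<dots> = (\<Sum>F\<in>{F \<in> \<F>. v \<in> F}. 2 ^ Suc i * x F)"
          by (simp add: w_def sum_distrib_left)
        also have "\<dots> \<le> (\<Sum>F\<in>{F \<in> \<F>. v \<in> F}. y F)" using le by (intro sum_mono) auto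
        finally show ?thesis .
      qed
    qed
    have "S \<subseteq> \<Union>\<F>" using UF by (auto simp: S_def)
    then have "fcov \<F> S \<le> (\<Sum>F\<in>\<F>. y F)" using fcov_attained(2)[OF finF _ cover] by blast
    also have "\<dots> = 4 * X + (\<Sum>j\<in>\<F> \<times> {2..m}. cost j * I \<theta> j)"
      unfolding y_def X_def by (simp add: sum.distrib sum_distrib_left sum.cartesian_product)
    also have "\<dots> \<le> 4 * X + 2 * (\<Sum>j\<in>\<F> \<times> {2..m}. cost j * (2 * (real k / 2 ^ snd j)))"
      using avg by simp
    \<comment> \<open>The charge \<open>2 ^ Suc i * x F\<close> times the interval length
      \<open>2 k / 2 ^ i\<close> is \<open>4 k * x F\<close>, independent of the scale. The outer
      factor 2 comes from averaging over an interval of length 1/2.\<close>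
    also have "(\<Sum>j\<in>\<F> \<times> {2..m}. cost j * (2 * (real k / 2 ^ snd j)))
        = (\<Sum>F\<in>\<F>. \<Sum>i\<in>{2..m}. 4 * real k * x F)"
      by (subst sum.cartesian_product) (auto intro!: sum.cong simp: cost_def)
    also have "\<dots> = (\<Sum>F\<in>\<F>. 4 * real k * (real m - 1) * x F)"
      using m(1) by (intro sum.cong refl) (simp add: algebra_simps)
    also have "\<dots> = 4 * real k * (real m - 1) * X"
      by (simp only: X_def sum_distrib_left)
    \<comment> \<open>The unconditional term \<open>4 * X\<close> is paid as one further scale,
      which turns \<open>m - 1\<close> into \<open>m\<close>.\<close>
    also have "4 * X + 2 * (4 * real k * (real m - 1) * X)
        \<le> 8 * real k * X + 8 * real k * (real m - 1) * X"
      using mult_right_mono[of 4 "8 * real k" X] X0 \<open>k > 0\<close> by simp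
    also have "\<dots> = 8 * real k * real m * X" by (simp add: algebra_simps)
    also have "\<dots> \<le> 8 * real k * log 2 (2 * real n) * X"
      using m(2) X0 by (intro mult_right_mono mult_left_mono) auto
    finally show ?thesis using sep unfolding X_def by blast
  qed
qed

end
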